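(* Let $p$ be a positive integer such that $p\equiv 3\pmod 4$. The following are equivalent. (i) There exists a balancedly multi-splittable $p^2\times p(p+1)$ partial Hadamard matrix. (ii) There exists a balancedly multi-splittable BIBD with parameters $$\left(p^2,\;p^2+p,\;\tfrac12(p^2-1),\;\tfrac12(p^2-p),\;\tfrac14(p^2-p-2)\right).$$
   Context: An $m\times n$ partial Hadamard matrix is an $m\times n$ matrix $H$ with entries in $\{1,-1\}$ such that $HH^\top=nI_m$. For $p\equiv 3\pmod 4$, a $p^2\times p(p+1)$ partial Hadamard matrix $H$ is balancedly multi-splittable if it can be put in a block form $H=[H_1\ \cdots\ H_{p+1}]$ (a partition of its columns), each $H_i$ being a $p^2\times p$ matrix, such that for every $(p+1)/2$-element subset $\{i_1,\ldots,i_{(p+1)/2}\}$ of $\{1,\ldots,p+1\}$, with $H'=[H_{i_1}\ \cdots\ H_{i_{(p+1)/2}}]$, all off-diagonal entries of $H'(H')^\top$ lie in $\{\frac{p+1}{2},-\frac{p+1}{2}\}$. BIBD parameters are listed as $(v,b,r,k,\lambda)$: $v$ points, $b$ blocks, each point in exactly $r$ blocks, each block of size $k$, each pair of distinct points in exactly $\lambda$ blocks. The incidence matrix is the $v\times b$ $(0,1)$-matrix with rows indexed by points and columns indexed by blocks. Let $p\equiv 3\pmod 4$ and let $\mathcal D$ be a BIBD with the parameters displayed in the claim, with incidence matrix $D$. $\mathcal D$ is balancedly multi-splittable if there is a block form $D=[D_1\ \cdots\ D_{p+1}]$ (a partition of the columns) such that each $D_i$ is a $p^2\times p$ matrix with all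 row sums equal to $\frac{p-1}{2}$, and for every $(p+1)/2$-element subset $\{i_1,\ldots,i_{(p+1)/2}\}$ of $\{1,\ldots,p+1\}$, each pair of distinct points occurs together in either $\frac{p^2-1}{8}$ or $\frac{p^2-2p-3}{8}$ of the blocks that are columns of $[D_{i_1}\ \cdots\ D_{i_{(p+1)/2}}]$. *)

theory Defs
  imports Jordan_Normal_Form.DL_Submatrix "HOL-Library.Multiset" "HOL-Library.Disjoint_Sets"
begin

definition partial_hadamard :: "nat \<Rightarrow> nat \<Rightarrow> int mat \<Rightarrow> bool" where
  "partial_hadamard m n H \<longleftrightarrow>
     H \<in> carrier_mat m n \<and> elements_mat H \<subseteq> {1, -1} \<and>
     H * transpose_mat H = of_nat n \<cdot>\<^sub>m 1\<^sub>m m"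

text \<open>A block form \<open>A = [A\<^sub>1 \<dots> A\<^sub>q]\<close> with every \<open>A\<^sub>i\<close> having \<open>w\<close> columns is given by the sets
  \<open>C i\<close> (\<open>1 \<le> i \<le> q\<close>) of (0-based) column indices of \<open>A\<close> that make up \<open>A\<^sub>i\<close>.
  The blocks need not consist of consecutive columns.\<close>

definition block_form :: "nat \<Rightarrow> nat \<Rightarrow> 'a mat \<Rightarrow> (nat \<Rightarrow> nat set) \<Rightarrow> bool" where
  "block_form q w A C \<longleftrightarrow>
     disjoint_family_on C {1..q} \<and> (\<Union>i\<in>{1..q}. C i) = {..<dim_col A} \<and>
     (\<forall>i\<in>{1..q}. card (C i) = w)"

text \<open>The matrix \<open>[A\<^bsub>i\<^sub>1\<^esub> A\<^bsub>i\<^sub>2\<^esub> \<dots>]\<close> for \<open>S = {i\<^sub>1, i\<^sub>2, \<dots>}\<close>. Its columns are kept in the order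
  in which they occur in \<open>A\<close>; row sums and the product with the transpose do not depend on it.\<close>

definition sub_blocks :: "'a mat \<Rightarrow> (nat \<Rightarrow> nat set) \<Rightarrow> nat set \<Rightarrow> 'a mat" where
  "sub_blocks A C S = submatrix A UNIV (\<Union>i\<in>S. C i)"

text \<open>In the definitions below \<open>p mod 4 = 3\<close> is intended; then all divisions are exact and
  no subtraction of natural numbers is truncated.\<close>

definition multi_splittable_hadamard :: "nat \<Rightarrow> int mat \<Rightarrow> bool" where
  "multi_splittable_hadamard p H \<longleftrightarrow>
     partial_hadamard (p\<^sup>2) (p * (p + 1)) H \<and>
     (\<exists>C. block_form (p + 1) p H C \<and>
        (\<forall>S \<subseteq> {1..p + 1}. card S = (p + 1) div 2 \<longrightarrow>
           (let H' = sub_blocks H C S in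
            \<forall>x < p\<^sup>2. \<forall>y < p\<^sup>2. x \<noteq> y \<longrightarrow>
              (H' * transpose_mat H') $$ (x, y)
                \<in> {int ((p + 1) div 2), - int ((p + 1) div 2)})))"

text \<open>Blocks form a multiset, i.e. repeated blocks are allowed.\<close>

definition bibd ::
    "'a set \<Rightarrow> 'a set multiset \<Rightarrow> nat \<Rightarrow> nat \<Rightarrow> nat \<Rightarrow> nat \<Rightarrow> nat \<Rightarrow> bool" where
  "bibd V \<B> v b r k l \<longleftrightarrow>
     finite V \<and> card V = v \<and> size \<B> = b \<and>
     (\<forall>B \<in># \<B>. B \<subseteq> V \<and> card B = k) \<and>
     (\<forall>x \<in> V. size {#B \<in># \<B>. x \<in> B#} = r) \<and>
     (\<forall>x \<in> V. \<forall>y \<in> V. x \<noteq> y \<longrightarrow> size {#B \<in># \<B>. x \<in> B \<and> y \<in> B#} = l)"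

definition incidence_matrix :: "'a list \<Rightarrow> 'a set list \<Rightarrow> int mat" where
  "incidence_matrix xs Bs =
     mat (length xs) (length Bs) (\<lambda>(i, j). if xs ! i \<in> Bs ! j then 1 else 0)"

text \<open>The lists \<open>xs\<close> and \<open>Bs\<close> enumerate the points and the blocks; column \<open>j\<close> of \<open>D\<close> is the
  block \<open>Bs ! j\<close>.\<close>

definition multi_splittable_bibd :: "nat \<Rightarrow> 'a set \<Rightarrow> 'a set multiset \<Rightarrow> bool" where
  "multi_splittable_bibd p V \<B> \<longleftrightarrow>
     bibd V \<B> (p\<^sup>2) (p\<^sup>2 + p) ((p\<^sup>2 - 1) div 2) ((p\<^sup>2 - p) div 2) ((p\<^sup>2 - p - 2) div 4) \<and>
     (\<exists>xs Bs C.
        distinct xs \<and> set xs = V \<and> mset Bs = \<B> \<and>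
        (let D = incidence_matrix xs Bs in
         block_form (p + 1) p D C \<and>
         (\<forall>i \<in> {1..p + 1}. \<forall>x < p\<^sup>2.
            (\<Sum>j<p. sub_blocks D C {i} $$ (x, j)) = int ((p - 1) div 2)) \<and>
         (\<forall>S \<subseteq> {1..p + 1}. card S = (p + 1) div 2 \<longrightarrow>
            (\<forall>x \<in> V. \<forall>y \<in> V. x \<noteq> y \<longrightarrow>
               card {j \<in> (\<Union>i\<in>S. C i). x \<in> Bs ! j \<and> y \<in> Bs ! j}
                 \<in> {(p\<^sup>2 - 1) div 8, (p\<^sup>2 - 2 * p - 3) div 8}))))"

end

theory Submission
  imports Defs
begin

text \<open>Put \<open>h = (p + 1) / 2\<close>. Two distinct rows \<open>x\<close>, \<open>y\<close> of a multi-splittable Hadamard matrix have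
  \<open>p + 1 = 2 * h\<close> inner products, one for each block of columns. These integers add up to \<open>0\<close>, and any
  \<open>h\<close> of them add up to \<open>\<plusminus>h\<close>. Trading one block for another in a half sum changes it by \<open>0\<close> or
  \<open>\<plusminus>2 * h\<close>, so at most two values occur, and counting leaves a single possibility: for some sign \<open>s\<close>
  one inner product is \<open>s * p\<close> and all others are \<open>- s\<close> (\<open>half_sums_profile\<close>). In other words, on
  exactly one block the two rows agree up to the sign \<open>s\<close>. Comparing both rows with a third one
  on that block shows that \<open>s\<close> is multiplicative, \<open>s x z = s x y * s y z\<close> (\<open>pair_sign_mult\<close>);
  hence multiplying each row \<open>x\<close> by \<open>s 0 x\<close> turns all these signs into \<open>1\<close>.

  After that, agreement on a block is an equivalence relation on the \<open>p\<^sup>2\<close> rows, and any two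
  rows agree on exactly one block: the classes are the lines of a linear space that has \<open>p + 1\<close>
  parallel classes. Joining the points of a line to a point off it shows that a line has at most \<open>p\<close>
  points (\<open>card_row_class_le\<close>), and averaging over the blocks shows that it has exactly \<open>p\<close>
  (\<open>card_row_class\<close>). So in each block every row is repeated \<open>p\<close> times, and a column sum is
  \<open>p\<close> times an integer, which is odd because \<open>p\<^sup>2\<close> is odd. The squares of the \<open>p\<close> column sums
  of a block add up to \<open>p\<^sup>3\<close>, so every column sum is \<open>\<plusminus>p\<close> (\<open>column_sum_squares\<close>).
  Changing signs of columns makes all of them \<open>- p\<close>, and then every row of every block has sum
  \<open>-1\<close> (\<open>normalized_row_sum\<close>).

  For a sign matrix whose rows have sum \<open>-1\<close> on each block, an inner product of two rows is an affine
  function of the number of columns in which both have a \<open>1\<close> (\<open>sum_products_eq\<close>). Replacing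
  \<open>-1\<close> by \<open>0\<close> therefore carries the conditions on Hadamard matrices to those on designs, and
  back (\<open>orth_iff\<close>, \<open>half_iff\<close>). The prescribed row sums of the incidence matrix say exactly that the
  sign matrix of a design is of this form, so the converse needs no further normalization.\<close>

section \<open>Sums over selected columns\<close>

text \<open>Columns of a submatrix are enumerated by \<open>pick\<close>; reindexing along it replaces sums over the
  columns of a submatrix by sums over the chosen columns of the whole matrix.\<close>

lemma bij_betw_pick:
  assumes "finite J"
  shows "bij_betw (pick J) {..<card J} J"
proof (rule bij_betw_imageI)
  show "inj_on (pick J) {..<card J}"
    by (rule inj_onI) (metis card_pick_le lessThan_iff)
  have "i \<in> pick J ` {..<card J}" if "i \<in> J" for i
  proof
    show "i = pick J (card {a \<in> J. a < i})"
      using pick_card_in_set[OF that] by simp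
    have "{a \<in> J. a < i} \<subset> J" using that by auto
    then show "card {a \<in> J. a < i} \<in> {..<card J}"
      using assms by (simp add: psubset_card_mono)
  qed
  then show "pick J ` {..<card J} = J"
    using pick_in_set_le by fastforce
qed

lemma submatrix_cols_index:
  assumes "J \<subseteq> {..<dim_col A}" "x < dim_row A" "j < card J"
  shows "submatrix A UNIV J $$ (x, j) = A $$ (x, pick J j)"
proof -
  have "{j. j < dim_col A \<and> j \<in> J} = J" using assms(1) by auto
  then show ?thesis
    using assms by (simp add: submatrix_index pick_UNIV)
qed

lemma dim_submatrix_cols:
  assumes "J \<subseteq> {..<dim_col A}"
  shows "dim_row (submatrix A UNIV J) = dim_row A" "dim_col (submatrix A UNIV J) = card J"
proof -
  have "{j. j < dim_col A \<and> j \<in> J} = J" using assms by auto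
  then show "dim_row (submatrix A UNIV J) = dim_row A" "dim_col (submatrix A UNIV J) = card J"
    by (simp_all add: dim_submatrix)
qed

lemma sum_submatrix_cols:
  assumes "J \<subseteq> {..<dim_col A}" "x < dim_row A"
  shows "(\<Sum>j<card J. submatrix A UNIV J $$ (x, j)) = (\<Sum>j\<in>J. A $$ (x, j))"
proof -
  have "finite J" using assms(1) finite_subset by blast
  have "(\<Sum>j<card J. submatrix A UNIV J $$ (x, j)) = (\<Sum>j<card J. A $$ (x, pick J j))"
    using assms by (intro sum.cong) (auto simp: submatrix_cols_index)
  also have "\<dots> = (\<Sum>j\<in>J. A $$ (x, j))"
    by (rule sum.reindex_bij_betw[OF bij_betw_pick[OF \<open>finite J\<close>]])
  finally show ?thesis .
qed

lemma gram_index: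
  assumes "x < dim_row A" "y < dim_row A"
  shows "(A * transpose_mat A) $$ (x, y) = (\<Sum>j<dim_col A. A $$ (x, j) * A $$ (y, j))"
  using assms by (simp add: scalar_prod_def atLeast0LessThan)

lemma gram_submatrix_cols:
  assumes J: "J \<subseteq> {..<dim_col A}" and xy: "x < dim_row A" "y < dim_row A"
  shows "(submatrix A UNIV J * transpose_mat (submatrix A UNIV J)) $$ (x, y)
           = (\<Sum>j\<in>J. A $$ (x, j) * A $$ (y, j))"
proof -
  have "finite J" using J finite_subset by blast
  have "(submatrix A UNIV J * transpose_mat (submatrix A UNIV J)) $$ (x, y)
      = (\<Sum>j<card J. A $$ (x, pick J j) * A $$ (y, pick J j))"
    by (subst gram_index)
       (use assms in \<open>auto simp: dim_submatrix_cols submatrix_cols_index intro!: sum.cong\<close>)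
  also have "\<dots> = (\<Sum>j\<in>J. A $$ (x, j) * A $$ (y, j))"
    by (rule sum.reindex_bij_betw[OF bij_betw_pick[OF \<open>finite J\<close>]])
  finally show ?thesis .
qed

text \<open>The diagonal of the Gram matrix is right as soon as the entries are signs.\<close>

lemma partial_hadamard_iff:
  "partial_hadamard m n H \<longleftrightarrow> H \<in> carrier_mat m n \<and>
     (\<forall>x<m. \<forall>j<n. H $$ (x, j) \<in> {1, -1}) \<and>
     (\<forall>x<m. \<forall>y<m. x \<noteq> y \<longrightarrow> (\<Sum>j<n. H $$ (x, j) * H $$ (y, j)) = 0)"
  (is "_ \<longleftrightarrow> _ \<and> ?sign \<and> ?orth")
proof (cases "H \<in> carrier_mat m n")
  case True
  have sign: "elements_mat H \<subseteq> {1, -1} \<longleftrightarrow> ?sign"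
    using True by (fastforce elim!: elements_matD[elim_format])
  have "H * transpose_mat H = of_nat n \<cdot>\<^sub>m 1\<^sub>m m \<longleftrightarrow> ?orth" if s: ?sign
  proof -
    have diag: "(\<Sum>j<n. H $$ (x, j) * H $$ (x, j)) = int n" if "x < m" for x
    proof -
      have "(\<Sum>j<n. H $$ (x, j) * H $$ (x, j)) = (\<Sum>j<n. 1)"
        using s that by (intro sum.cong) fastforce+
      then show ?thesis by simp
    qed
    have "H * transpose_mat H = of_nat n \<cdot>\<^sub>m 1\<^sub>m m \<longleftrightarrow>
        (\<forall>x<m. \<forall>y<m. (\<Sum>j<n. H $$ (x, j) * H $$ (y, j)) = (if x = y then int n else 0))"
      using True by (auto simp: mat_eq_iff gram_index simp del: index_mult_mat(1))
    also have "\<dots> \<longleftrightarrow> ?orth"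
      using diag by auto
    finally show ?thesis .
  qed
  then show ?thesis
    using True sign unfolding partial_hadamard_def by blast
qed (simp add: partial_hadamard_def)

section \<open>Integers whose half sums have constant absolute value\<close>

text \<open>Half sums that differ in one index show that \<open>a\<close> takes only the values \<open>M\<close> and \<open>M - 2 * h\<close>, and
  the vanishing total identifies \<open>M\<close> with the number of low values. If both values occurred at least twice,
  trading two high values for two low ones would change a half sum by \<open>4 * h\<close>, which is more than
  the distance from \<open>- h\<close> to \<open>h\<close>. If there were no low value, all of \<open>a\<close> would vanish. So exactly one
  value is exceptional, and it is the low one or the high one according to the sign.\<close>

lemma half_sums_profile:
  fixes a :: "'i \<Rightarrow> int" and h :: nat
  assumes fin: "finite I" and cI: "card I = 2 * h" and h: "h \<ge> 2"
    and total: "sum a I = 0"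
    and half: "\<And>S. S \<subseteq> I \<Longrightarrow> card S = h \<Longrightarrow> sum a S \<in> {int h, - int h}"
  shows "\<exists>s\<in>{1, -1}. \<exists>i\<in>I. a i = s * (2 * int h - 1) \<and> (\<forall>k\<in>I - {i}. a k = - s)"
proof -
  \<comment> \<open>Exchange \<open>j\<close> for \<open>i\<close> in a half subset that contains exactly one of them.\<close>
  have diff: "a i - a j \<in> {0, 2 * int h, - 2 * int h}" if "i \<in> I" "j \<in> I" "i \<noteq> j" for i j
  proof -
    have "card (I - {i, j}) = 2 * h - 2"
      using that fin cI by (simp add: card_Diff_subset)
    then have "h - 1 \<le> card (I - {i, j})" using h by simp
    then obtain T where T: "T \<subseteq> I - {i, j}" "card T = h - 1" "finite T"
      by (rule obtain_subset_with_card_n)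
    have nT: "i \<notin> T" "j \<notin> T" using T by auto
    have "insert i T \<subseteq> I" "insert j T \<subseteq> I" "card (insert i T) = h" "card (insert j T) = h"
      using that T nT h by auto
    then have "sum a (insert i T) \<in> {int h, - int h}" "sum a (insert j T) \<in> {int h, - int h}"
      using half by blast+
    with nT show ?thesis using \<open>finite T\<close> by auto
  qed
  have ne: "I \<noteq> {}" using cI h by auto
  define M where "M = Max (a ` I)"
  have "M \<in> a ` I" unfolding M_def using fin ne by (intro Max_in) auto
  then obtain w where w: "w \<in> I" "a w = M" by auto
  have le: "a i \<le> M" if "i \<in> I" for i
    unfolding M_def using that fin by simp
  define L where "L = {i \<in> I. a i \<noteq> M}"
  have LI: "L \<subseteq> I" "finite L" using fin by (auto simp: L_def)
  have low: "a i = M - 2 * int h" if "i \<in> L" for i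
  proof -
    have "i \<in> I" "i \<noteq> w" "a i \<noteq> M" using that w by (auto simp: L_def)
    then show ?thesis using diff[of i w] w le[of i] by auto
  qed
  have high: "a i = M" if "i \<in> I - L" for i
    using that by (auto simp: L_def)
  have "sum a I = sum a (I - L) + sum a L"
    using sum.subset_diff[OF LI(1) fin] .
  also have "sum a (I - L) = int (card (I - L)) * M" using high by simp
  also have "sum a L = int (card L) * (M - 2 * int h)" using low by simp
  also have "int (card (I - L)) = 2 * int h - int (card L)"
    using LI fin cI card_mono[OF fin LI(1)] by (simp add: card_Diff_subset)
  finally have "2 * int h * int (card L) = 2 * int h * M"
    using total by (simp add: algebra_simps)
  then have M: "M = int (card L)" using h by simp
  have "L \<noteq> {}"
  proof
    assume "L = {}"
    obtain S where S: "S \<subseteq> I" "card S = h" "finite S"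
      using obtain_subset_with_card_n[of h I] cI by (metis le_add1 mult_2)
    have "sum a S = 0"
      using high M \<open>L = {}\<close> S by (intro sum.neutral) auto
    then show False using half[OF S(1,2)] h by auto
  qed
  consider (one) "card L = 1" | (two) "card (I - L) = 1" | (many) "card L \<ge> 2" "card (I - L) \<ge> 2"
  proof -
    have "card L \<noteq> 0" using \<open>L \<noteq> {}\<close> LI by simp
    moreover have "card (I - L) \<noteq> 0" using w fin by (auto simp: L_def)
    ultimately show ?thesis using that by linarith
  qed
  then show ?thesis
  proof cases
    case one
    then obtain i where "L = {i}" by (auto simp: card_1_singleton_iff)
    then show ?thesis
      using low high M LI by (intro bexI[of _ "-1"] bexI[of _ i]) auto
  next
    case two
    then obtain i where i: "I - L = {i}" by (auto simp: card_1_singleton_iff)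
    have "int (card L) = 2 * int h - 1"
      using two LI fin cI card_mono[OF fin LI(1)] by (simp add: card_Diff_subset)
    moreover have "k \<in> L" if "k \<in> I - {i}" for k using that i by auto
    ultimately show ?thesis
      using low high M i by (intro bexI[of _ 1] bexI[of _ i]) auto
  next
    case many
    obtain U where U: "U \<subseteq> L" "card U = 2"
      using obtain_subset_with_card_n[OF many(1)] by auto
    obtain W where W: "W \<subseteq> I - L" "card W = 2"
      using obtain_subset_with_card_n[OF many(2)] by auto
    have fUW: "finite U" "finite W" using U W by (auto intro: card_ge_0_finite)
    have "U \<inter> W = {}" using U W by auto
    then have "card (U \<union> W) = 4" using fUW U W by (simp add: card_Un_disjoint)
    moreover have "U \<union> W \<subseteq> I" using U W LI by auto
    ultimately have "card (I - (U \<union> W)) = 2 * h - 4"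
      using fUW cI by (simp add: card_Diff_subset)
    then have "h - 2 \<le> card (I - (U \<union> W))" by simp
    then obtain T where T: "T \<subseteq> I - (U \<union> W)" "card T = h - 2" "finite T"
      by (rule obtain_subset_with_card_n)
    have d: "T \<inter> U = {}" "T \<inter> W = {}" using T by auto
    have "card (T \<union> U) = h" "card (T \<union> W) = h"
      using T U W fUW d h by (simp_all add: card_Un_disjoint)
    moreover have "T \<union> U \<subseteq> I" "T \<union> W \<subseteq> I" using T \<open>U \<union> W \<subseteq> I\<close> by auto
    ultimately have "sum a (T \<union> U) \<in> {int h, - int h}" "sum a (T \<union> W) \<in> {int h, - int h}"
      using half by blast+
    moreover have "sum a (T \<union> U) = sum a T + 2 * (M - 2 * int h)"
      using T fUW d U low by (simp add: sum.union_disjoint subset_iff)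
    moreover have "sum a (T \<union> W) = sum a T + 2 * M"
      using T fUW d W high by (simp add: sum.union_disjoint subset_iff)
    ultimately show ?thesis using h by auto
  qed
qed

section \<open>Counting with signs\<close>

lemma sum_signs:
  fixes g :: "'j \<Rightarrow> int"
  assumes "finite J" "\<And>j. j \<in> J \<Longrightarrow> g j \<in> {1, -1}"
  shows "sum g J = 2 * int (card {j \<in> J. g j = 1}) - int (card J)"
proof -
  have "sum g J = (\<Sum>j\<in>J. 2 * of_bool (g j = 1) - 1)"
    using assms(2) by (intro sum.cong) fastforce+
  also have "\<dots> = 2 * int (card {j \<in> J. g j = 1}) - int (card J)"
    using assms(1) by (simp add: sum_subtractf sum_distrib_left[symmetric] Int_def)
  finally show ?thesis .
qed

text \<open>For signs \<open>f\<close> and \<open>g\<close> this expands \<open>(2 * [f = 1] - 1) * (2 * [g = 1] - 1)\<close>.\<close>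

lemma sum_sign_products:
  fixes f g :: "'j \<Rightarrow> int"
  assumes "finite J" "\<And>j. j \<in> J \<Longrightarrow> f j \<in> {1, -1}" "\<And>j. j \<in> J \<Longrightarrow> g j \<in> {1, -1}"
  shows "(\<Sum>j\<in>J. f j * g j) = 4 * int (card {j \<in> J. f j = 1 \<and> g j = 1})
           - 2 * int (card {j \<in> J. f j = 1}) - 2 * int (card {j \<in> J. g j = 1}) + int (card J)"
proof -
  have "(\<Sum>j\<in>J. f j * g j) = (\<Sum>j\<in>J. 4 * of_bool (f j = 1 \<and> g j = 1)
           - 2 * of_bool (f j = 1) - 2 * of_bool (g j = 1) + 1)"
    using assms(2,3) by (intro sum.cong) fastforce+
  also have "\<dots> = 4 * int (card {j \<in> J. f j = 1 \<and> g j = 1})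
           - 2 * int (card {j \<in> J. f j = 1}) - 2 * int (card {j \<in> J. g j = 1}) + int (card J)"
    using assms(1)
    by (simp add: sum_subtractf sum.distrib sum_distrib_left[symmetric] Int_def)
  finally show ?thesis .
qed


section \<open>Sign matrices divided into blocks of columns\<close>

locale sign_blocks =
  fixes p :: nat and H :: "nat \<Rightarrow> nat \<Rightarrow> int" and C :: "nat \<Rightarrow> nat set"
  assumes p_mod: "p mod 4 = 3"
    and disj: "disjoint_family_on C {1..p + 1}"
    and card_C: "i \<in> {1..p + 1} \<Longrightarrow> card (C i) = p"
    and sign: "x < p\<^sup>2 \<Longrightarrow> i \<in> {1..p + 1} \<Longrightarrow> j \<in> C i \<Longrightarrow> H x j \<in> {1, -1}"
begin

lemma p_ge_3: "p \<ge> 3"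
  using p_mod by (metis mod_less_eq_dividend)

lemma odd_p: "odd p"
  using p_mod by presburger

lemma finite_C: "i \<in> {1..p + 1} \<Longrightarrow> finite (C i)"
  using card_C p_ge_3 by (intro card_ge_0_finite) auto

lemma
  assumes "S \<subseteq> {1..p + 1}"
  shows finite_columns: "finite (\<Union>i\<in>S. C i)"
    and card_columns: "card (\<Union>i\<in>S. C i) = card S * p"
    and sum_columns: "(\<Sum>j\<in>(\<Union>i\<in>S. C i). f j) = (\<Sum>i\<in>S. \<Sum>j\<in>C i. f j)"
proof -
  have fin: "finite S" "\<forall>i\<in>S. finite (C i)"
    using assms finite_C finite_subset by blast+
  have disj': "\<forall>i\<in>S. \<forall>j\<in>S. i \<noteq> j \<longrightarrow> C i \<inter> C j = {}"
    using disj assms unfolding disjoint_family_on_def by blast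
  show "finite (\<Union>i\<in>S. C i)" using fin by blast
  have "card (\<Union>i\<in>S. C i) = (\<Sum>i\<in>S. card (C i))"
    using fin disj' by (rule card_UN_disjoint)
  also have "\<dots> = card S * p"
    using card_C assms by (simp add: subset_iff)
  finally show "card (\<Union>i\<in>S. C i) = card S * p" .
  show "(\<Sum>j\<in>(\<Union>i\<in>S. C i). f j) = (\<Sum>i\<in>S. \<Sum>j\<in>C i. f j)"
    using fin disj' by (rule sum.UNION_disjoint)
qed

definition block_ip :: "nat \<Rightarrow> nat \<Rightarrow> nat \<Rightarrow> int" where
  "block_ip i x y = (\<Sum>j\<in>C i. H x j * H y j)"

lemma block_ip_sym: "block_ip i x y = block_ip i y x"
  by (simp add: block_ip_def mult.commute)

lemma block_ip_self:
  assumes "x < p\<^sup>2" "i \<in> {1..p + 1}"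
  shows "block_ip i x x = int p"
proof -
  have "block_ip i x x = (\<Sum>j\<in>C i. 1)"
    unfolding block_ip_def using sign[OF assms] by (intro sum.cong) fastforce+
  then show ?thesis using card_C[OF assms(2)] by simp
qed

text \<open>A sum of \<open>p\<close> signs can only reach \<open>p\<close> if all of them are \<open>1\<close>.\<close>

lemma rows_agree:
  assumes x: "x < p\<^sup>2" and y: "y < p\<^sup>2" and i: "i \<in> {1..p + 1}" and s: "s \<in> {1, -1}"
    and block_ip: "block_ip i x y = s * int p" and j: "j \<in> C i"
  shows "H x j = s * H y j"
proof -
  have "(\<Sum>j\<in>C i. 1 - s * (H x j * H y j)) = int p - s * block_ip i x y"
    using card_C[OF i] by (simp add: sum_subtractf sum_distrib_left block_ip_def)
  then have "(\<Sum>j\<in>C i. 1 - s * (H x j * H y j)) = 0"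
    using s block_ip by auto
  moreover have "0 \<le> 1 - s * (H x j * H y j)" if "j \<in> C i" for j
    using s sign[OF x i that] sign[OF y i that] by auto
  ultimately have "1 - s * (H x j * H y j) = 0"
    using sum_nonneg_eq_0_iff[OF finite_C[OF i], of "\<lambda>j. 1 - s * (H x j * H y j)"] j by blast
  then show ?thesis
    using s sign[OF x i j] sign[OF y i j] by auto
qed

end

text \<open>The conditions on a multi-splittable Hadamard matrix, freed of submatrices and matrix products.\<close>

locale balanced_split = sign_blocks +
  assumes orth: "x < p\<^sup>2 \<Longrightarrow> y < p\<^sup>2 \<Longrightarrow> x \<noteq> y \<Longrightarrow>
      (\<Sum>j\<in>(\<Union>i\<in>{1..p + 1}. C i). H x j * H y j) = 0"
    and half: "S \<subseteq> {1..p + 1} \<Longrightarrow> card S = (p + 1) div 2 \<Longrightarrow>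
      x < p\<^sup>2 \<Longrightarrow> y < p\<^sup>2 \<Longrightarrow> x \<noteq> y \<Longrightarrow>
      (\<Sum>j\<in>(\<Union>i\<in>S. C i). H x j * H y j) \<in> {int ((p + 1) div 2), - int ((p + 1) div 2)}"

lemma multi_splittable_hadamard_iff:
  assumes p: "p mod 4 = 3"
  shows "multi_splittable_hadamard p H \<longleftrightarrow> H \<in> carrier_mat (p\<^sup>2) (p * (p + 1)) \<and>
    (\<exists>C. (\<Union>i\<in>{1..p + 1}. C i) = {..<p * (p + 1)} \<and> balanced_split p (\<lambda>x j. H $$ (x, j)) C)"
proof (cases "H \<in> carrier_mat (p\<^sup>2) (p * (p + 1))")
  case True
  have gram: "(sub_blocks H C S * transpose_mat (sub_blocks H C S)) $$ (x, y)
      = (\<Sum>j\<in>(\<Union>i\<in>S. C i). H $$ (x, j) * H $$ (y, j))"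
    if "(\<Union>i\<in>{1..p + 1}. C i) = {..<p * (p + 1)}" "S \<subseteq> {1..p + 1}" "x < p\<^sup>2" "y < p\<^sup>2" for C S x y
  proof -
    have "(\<Union>i\<in>S. C i) \<subseteq> {..<p * (p + 1)}" using that(1,2) by blast
    then show ?thesis
      unfolding sub_blocks_def using True that by (intro gram_submatrix_cols) auto
  qed
  have "multi_splittable_hadamard p H \<longleftrightarrow>
      (\<exists>C. (\<Union>i\<in>{1..p + 1}. C i) = {..<p * (p + 1)} \<and> disjoint_family_on C {1..p + 1} \<and>
        (\<forall>i\<in>{1..p + 1}. card (C i) = p) \<and>
        (\<forall>x<p\<^sup>2. \<forall>j<p * (p + 1). H $$ (x, j) \<in> {1, -1}) \<and>
        (\<forall>x<p\<^sup>2. \<forall>y<p\<^sup>2. x \<noteq> y \<longrightarrow> (\<Sum>j<p * (p + 1). H $$ (x, j) * H $$ (y, j)) = 0) \<and>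
        (\<forall>S\<subseteq>{1..p + 1}. card S = (p + 1) div 2 \<longrightarrow> (\<forall>x<p\<^sup>2. \<forall>y<p\<^sup>2. x \<noteq> y \<longrightarrow>
          (sub_blocks H C S * transpose_mat (sub_blocks H C S)) $$ (x, y)
            \<in> {int ((p + 1) div 2), - int ((p + 1) div 2)})))"
    using True unfolding multi_splittable_hadamard_def partial_hadamard_iff block_form_def Let_def
    by auto
  also have "\<dots> \<longleftrightarrow> (\<exists>C. (\<Union>i\<in>{1..p + 1}. C i) = {..<p * (p + 1)} \<and>
      balanced_split p (\<lambda>x j. H $$ (x, j)) C)"
  proof (intro ex_cong1 conj_cong refl)
    fix C :: "nat \<Rightarrow> nat set"
    assume cover: "(\<Union>i\<in>{1..p + 1}. C i) = {..<p * (p + 1)}"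
    have mem: "j < p * (p + 1) \<longleftrightarrow> (\<exists>i\<in>{1..p + 1}. j \<in> C i)" for j
      using cover by blast
    show "(disjoint_family_on C {1..p + 1} \<and>
        (\<forall>i\<in>{1..p + 1}. card (C i) = p) \<and>
        (\<forall>x<p\<^sup>2. \<forall>j<p * (p + 1). H $$ (x, j) \<in> {1, -1}) \<and>
        (\<forall>x<p\<^sup>2. \<forall>y<p\<^sup>2. x \<noteq> y \<longrightarrow> (\<Sum>j<p * (p + 1). H $$ (x, j) * H $$ (y, j)) = 0) \<and>
        (\<forall>S\<subseteq>{1..p + 1}. card S = (p + 1) div 2 \<longrightarrow> (\<forall>x<p\<^sup>2. \<forall>y<p\<^sup>2. x \<noteq> y \<longrightarrow>
          (sub_blocks H C S * transpose_mat (sub_blocks H C S)) $$ (x, y)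
            \<in> {int ((p + 1) div 2), - int ((p + 1) div 2)}))) \<longleftrightarrow>
      balanced_split p (\<lambda>x j. H $$ (x, j)) C" (is "?L \<longleftrightarrow> ?R")
    proof
      assume L: ?L
      have "H $$ (x, j) \<in> {1, -1}" if "x < p\<^sup>2" "i \<in> {1..p + 1}" "j \<in> C i" for x i j
      proof -
        have "\<forall>x<p\<^sup>2. \<forall>j<p * (p + 1). H $$ (x, j) \<in> {1, -1}" using L by (elim conjE)
        moreover have "j < p * (p + 1)" using that(2,3) mem by blast
        ultimately show ?thesis using that(1) by blast
      qed
      with L show ?R
        using p by unfold_locales (unfold cover, auto simp: gram[OF cover])
    next
      assume R: ?R
      then interpret balanced_split p "\<lambda>x j. H $$ (x, j)" C .
      have "H $$ (x, j) \<in> {1, -1}" if "x < p\<^sup>2" "j < p * (p + 1)" for x j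
        using sign that mem by blast
      then show ?L
        using disj card_C orth[unfolded cover] half gram[OF cover] by auto
    qed
  qed
  finally show ?thesis using True by simp
qed (simp add: multi_splittable_hadamard_def partial_hadamard_def)

section \<open>From a multi-splittable Hadamard matrix to a parallel structure on the rows\<close>

context balanced_split
begin

lemma block_ip_profile:
  assumes "x < p\<^sup>2" "y < p\<^sup>2" "x \<noteq> y"
  shows "\<exists>s\<in>{1, -1}. \<exists>i\<in>{1..p + 1}. block_ip i x y = s * int p \<and>
    (\<forall>k\<in>{1..p + 1} - {i}. block_ip k x y = - s)"
proof -
  define h where "h = (p + 1) div 2"
  have h: "2 * h = p + 1" "h \<ge> 2" using odd_p p_ge_3 by (auto simp: h_def)
  have "\<exists>s\<in>{1, -1}. \<exists>i\<in>{1..p + 1}. block_ip i x y = s * (2 * int h - 1) \<and>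
      (\<forall>k\<in>{1..p + 1} - {i}. block_ip k x y = - s)"
  proof (rule half_sums_profile)
    show "(\<Sum>i\<in>{1..p + 1}. block_ip i x y) = 0"
      using orth[OF assms] sum_columns[OF order_refl, of "\<lambda>j. H x j * H y j"] by (simp add: block_ip_def)
    show "(\<Sum>i\<in>S. block_ip i x y) \<in> {int h, - int h}" if "S \<subseteq> {1..p + 1}" "card S = h" for S
      using half[OF that[unfolded h_def] assms] sum_columns[OF that(1), of "\<lambda>j. H x j * H y j"]
      by (simp add: block_ip_def h_def)
  qed (use h in auto)
  moreover have "2 * int h - 1 = int p" using h by linarith
  ultimately show ?thesis by simp
qed

text \<open>For distinct rows this is the sign of the profile: when the sign is \<open>-1\<close> the inner products are
  \<open>- p\<close> and \<open>1\<close>, and \<open>p\<close> is not among them. On the diagonal the value is \<open>1\<close>.\<close>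

definition pair_sign :: "nat \<Rightarrow> nat \<Rightarrow> int" where
  "pair_sign x y = (if \<exists>i\<in>{1..p + 1}. block_ip i x y = int p then 1 else -1)"

lemma pair_sign_profile:
  assumes "x < p\<^sup>2" "y < p\<^sup>2" "x \<noteq> y"
  shows "\<exists>i\<in>{1..p + 1}. block_ip i x y = pair_sign x y * int p \<and>
    (\<forall>k\<in>{1..p + 1} - {i}. block_ip k x y = - pair_sign x y)"
proof -
  obtain s i where s: "s \<in> {1, -1}" and i: "i \<in> {1..p + 1}" "block_ip i x y = s * int p"
    "\<forall>k\<in>{1..p + 1} - {i}. block_ip k x y = - s"
    using block_ip_profile[OF assms] by blast
  have "pair_sign x y = s"
  proof (cases "s = 1")
    case True
    then show ?thesis using i by (auto simp: pair_sign_def)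
  next
    case False
    then have "s = -1" using s by simp
    then have "block_ip k x y \<noteq> int p" if "k \<in> {1..p + 1}" for k
      using i that p_ge_3 by (cases "k = i") auto
    then show ?thesis using \<open>s = -1\<close> by (auto simp: pair_sign_def)
  qed
  with i show ?thesis by blast
qed

lemma pair_sign_values: "pair_sign x y \<in> {1, -1}"
  by (simp add: pair_sign_def)

lemma pair_sign_sym: "pair_sign x y = pair_sign y x"
  by (simp add: pair_sign_def block_ip_sym)

lemma pair_sign_self: "x < p\<^sup>2 \<Longrightarrow> pair_sign x x = 1"
  using block_ip_self[of x 1] by (force simp: pair_sign_def)

text \<open>On the block where \<open>x\<close> is \<open>pair_sign x y\<close> times \<open>y\<close>, the inner products of \<open>x\<close> and of \<open>y\<close> with
  \<open>z\<close> differ by that factor. They have the same absolute value, \<open>p\<close> or \<open>1\<close>, so both stand for the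
  exceptional block of their pair or both do not, and their signs can be compared.\<close>

lemma pair_sign_mult:
  assumes x: "x < p\<^sup>2" and y: "y < p\<^sup>2" and z: "z < p\<^sup>2"
  shows "pair_sign x z = pair_sign x y * pair_sign y z"
proof -
  consider "x = y" | "y = z" | "x = z" "x \<noteq> y" | "x \<noteq> y" "y \<noteq> z" "x \<noteq> z" by blast
  then show ?thesis
  proof cases
    case 3
    then show ?thesis
      using pair_sign_self[OF x] pair_sign_sym[of x y] pair_sign_values[of x y] by auto
  next
    case 4
    obtain i where i: "i \<in> {1..p + 1}" "block_ip i x y = pair_sign x y * int p"
      using pair_sign_profile[OF x y 4(1)] by blast
    have "block_ip i x z = (\<Sum>j\<in>C i. pair_sign x y * (H y j * H z j))"
      unfolding block_ip_def
      using rows_agree[OF x y i(1) pair_sign_values i(2)] by (intro sum.cong) auto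
    then have eq: "block_ip i x z = pair_sign x y * block_ip i y z"
      by (simp add: block_ip_def sum_distrib_left)
    have xz: "block_ip i x z \<in> {pair_sign x z * int p, - pair_sign x z}"
      using pair_sign_profile[OF x z 4(3)] i(1) by blast
    have yz: "block_ip i y z \<in> {pair_sign y z * int p, - pair_sign y z}"
      using pair_sign_profile[OF y z 4(2)] i(1) by blast
    show ?thesis
      using eq xz yz pair_sign_values[of x y] pair_sign_values[of x z] pair_sign_values[of y z] p_ge_3
      by auto
  qed (use x y pair_sign_self in auto)
qed

lemma balanced_split_rescale:
  assumes e: "\<And>x. x < p\<^sup>2 \<Longrightarrow> e x \<in> {1, -1}"
    and d: "\<And>i j. i \<in> {1..p + 1} \<Longrightarrow> j \<in> C i \<Longrightarrow> d j \<in> {1, -1}"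
  shows "balanced_split p (\<lambda>x j. e x * d j * H x j) C"
proof -
  have prod: "(\<Sum>j\<in>(\<Union>i\<in>S. C i). e x * d j * H x j * (e y * d j * H y j))
      = e x * e y * (\<Sum>j\<in>(\<Union>i\<in>S. C i). H x j * H y j)"
    if "S \<subseteq> {1..p + 1}" for S x y
  proof -
    have "d j * d j = 1" if "j \<in> (\<Union>i\<in>S. C i)" for j
      using d that \<open>S \<subseteq> {1..p + 1}\<close> by fastforce
    then have "e x * d j * H x j * (e y * d j * H y j) = e x * e y * (H x j * H y j)"
      if "j \<in> (\<Union>i\<in>S. C i)" for j
      using that by (metis (no_types, lifting) mult.assoc mult.left_commute mult.right_neutral)
    then show ?thesis
      unfolding sum_distrib_left by (intro sum.cong) auto
  qed
  show ?thesis
  proof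
    show "e x * d j * H x j \<in> {1, -1}" if "x < p\<^sup>2" "i \<in> {1..p + 1}" "j \<in> C i" for x i j
      using e[OF that(1)] d[OF that(2,3)] sign[OF that] by auto
    show "(\<Sum>j\<in>(\<Union>i\<in>{1..p + 1}. C i). e x * d j * H x j * (e y * d j * H y j)) = 0"
      if "x < p\<^sup>2" "y < p\<^sup>2" "x \<noteq> y" for x y
      unfolding prod[OF order_refl] using orth[OF that] by simp
    show "(\<Sum>j\<in>(\<Union>i\<in>S. C i). e x * d j * H x j * (e y * d j * H y j))
        \<in> {int ((p + 1) div 2), - int ((p + 1) div 2)}"
      if "S \<subseteq> {1..p + 1}" "card S = (p + 1) div 2" "x < p\<^sup>2" "y < p\<^sup>2" "x \<noteq> y" for S x y
      unfolding prod[OF that(1)] using half[OF that] e[OF that(3)] e[OF that(4)] by auto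
  qed (use p_mod disj card_C in auto)
qed

end

text \<open>All pair signs are \<open>1\<close>. Then rows can be viewed as points, and the rows that agree on a block as
  the parallel lines belonging to that block; any two points are on exactly one line.\<close>

locale net_split = sign_blocks +
  assumes block_ip_net: "x < p\<^sup>2 \<Longrightarrow> y < p\<^sup>2 \<Longrightarrow> x \<noteq> y \<Longrightarrow>
      \<exists>i\<in>{1..p + 1}. block_ip i x y = int p \<and> (\<forall>k\<in>{1..p + 1} - {i}. block_ip k x y = -1)"

lemma (in balanced_split) net_split_switched:
  "net_split p (\<lambda>x j. pair_sign 0 x * H x j) C"
proof -
  interpret switched: balanced_split p "\<lambda>x j. pair_sign 0 x * H x j" C
    using balanced_split_rescale[of "pair_sign 0" "\<lambda>_. 1"] pair_sign_values by auto
  show ?thesis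
  proof
    fix x y assume xy: "x < p\<^sup>2" "y < p\<^sup>2" "x \<noteq> y"
    have "0 < p\<^sup>2" using p_ge_3 by simp
    then have "pair_sign x y = pair_sign 0 x * pair_sign 0 y"
      using pair_sign_mult[of x 0 y] pair_sign_sym xy by simp
    then have block_ip: "switched.block_ip i x y = pair_sign x y * block_ip i x y" for i
      unfolding switched.block_ip_def block_ip_def sum_distrib_left by (intro sum.cong) (auto simp: mult_ac)
    obtain i where i: "i \<in> {1..p + 1}" "block_ip i x y = pair_sign x y * int p"
      "\<forall>k\<in>{1..p + 1} - {i}. block_ip k x y = - pair_sign x y"
      using pair_sign_profile[OF xy] by blast
    have "pair_sign x y * pair_sign x y = 1"
      using pair_sign_values[of x y] by auto
    then have "switched.block_ip i x y = int p" "\<forall>k\<in>{1..p + 1} - {i}. switched.block_ip k x y = -1"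
      unfolding block_ip using i(2,3) by (simp_all flip: mult.assoc)
    with i(1) show "\<exists>i\<in>{1..p + 1}. switched.block_ip i x y = int p \<and>
        (\<forall>k\<in>{1..p + 1} - {i}. switched.block_ip k x y = -1)"
      by blast
  qed
qed

context net_split
begin

definition row_class :: "nat \<Rightarrow> nat \<Rightarrow> nat set" where
  "row_class i x = {y \<in> {..<p\<^sup>2}. \<forall>j\<in>C i. H y j = H x j}"

lemma row_class_iff:
  assumes "x < p\<^sup>2" "i \<in> {1..p + 1}"
  shows "y \<in> row_class i x \<longleftrightarrow> y < p\<^sup>2 \<and> block_ip i x y = int p"
proof
  assume y: "y \<in> row_class i x"
  then have "block_ip i x y = block_ip i x x"
    unfolding block_ip_def row_class_def by (intro sum.cong) auto
  then show "y < p\<^sup>2 \<and> block_ip i x y = int p"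
    using y block_ip_self[OF assms] by (simp add: row_class_def)
next
  assume "y < p\<^sup>2 \<and> block_ip i x y = int p"
  then show "y \<in> row_class i x"
    using rows_agree[of x y i 1] assms by (simp add: row_class_def)
qed

lemma block_ip_values:
  assumes "x < p\<^sup>2" "y < p\<^sup>2" "i \<in> {1..p + 1}"
  shows "block_ip i x y = (if y \<in> row_class i x then int p else -1)"
proof (cases "x = y")
  case True
  then show ?thesis using assms block_ip_self by (simp add: row_class_def)
next
  case False
  then have "block_ip i x y \<in> {int p, -1}" using block_ip_net assms by blast
  then show ?thesis using row_class_iff assms by auto
qed

lemma row_class_unique:
  assumes "x < p\<^sup>2" "i \<in> {1..p + 1}" "k \<in> {1..p + 1}"
    and "y \<in> row_class i x" "y \<in> row_class k x" "x \<noteq> y"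
  shows "i = k"
proof (rule ccontr)
  assume "i \<noteq> k"
  have "y < p\<^sup>2" "block_ip i x y = int p" "block_ip k x y = int p" using assms row_class_iff by blast+
  moreover from this obtain l where
    "\<forall>m\<in>{1..p + 1} - {l}. block_ip m x y = -1" using block_ip_net assms by blast
  then have "block_ip i x y = -1 \<or> block_ip k x y = -1" using \<open>i \<noteq> k\<close> assms(2,3) by blast
  ultimately show False by auto
qed

definition column_sum :: "nat \<Rightarrow> int" where
  "column_sum j = (\<Sum>x<p\<^sup>2. H x j)"

lemma sum_column_sum: "(\<Sum>j\<in>C i. H x j * column_sum j) = (\<Sum>y<p\<^sup>2. block_ip i x y)"
  unfolding column_sum_def block_ip_def sum_distrib_left by (rule sum.swap)

text \<open>Both sides are the squared length of the sum of all rows, restricted to the block \<open>i\<close>. The left one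
  shows that it is nonnegative.\<close>

lemma sum_column_sum_squares:
  "(\<Sum>j\<in>C i. (column_sum j)\<^sup>2) = (\<Sum>x<p\<^sup>2. \<Sum>y<p\<^sup>2. block_ip i x y)"
proof -
  have "(\<Sum>j\<in>C i. (column_sum j)\<^sup>2) = (\<Sum>j\<in>C i. \<Sum>x<p\<^sup>2. H x j * column_sum j)"
    by (simp add: column_sum_def power2_eq_square sum_distrib_right)
  also have "\<dots> = (\<Sum>x<p\<^sup>2. \<Sum>j\<in>C i. H x j * column_sum j)" by (rule sum.swap)
  finally show ?thesis by (simp add: sum_column_sum)
qed

lemma sum_ip_row:
  assumes "x < p\<^sup>2" "i \<in> {1..p + 1}"
  shows "(\<Sum>y<p\<^sup>2. block_ip i x y) = (int p + 1) * int (card (row_class i x)) - (int p)\<^sup>2"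
proof -
  have sub: "row_class i x \<subseteq> {..<p\<^sup>2}" by (auto simp: row_class_def)
  have "(\<Sum>y<p\<^sup>2. block_ip i x y) = (\<Sum>y<p\<^sup>2. (int p + 1) * of_bool (y \<in> row_class i x) - 1)"
    using block_ip_values[OF assms(1) _ assms(2)] by (intro sum.cong) auto
  also have "\<dots> = (int p + 1) * int (card ({..<p\<^sup>2} \<inter> row_class i x)) - (int p)\<^sup>2"
    by (simp add: sum_subtractf sum_distrib_left[symmetric])
  finally show ?thesis using sub by (simp add: Int_absorb1)
qed

text \<open>If all rows agreed on one block, any two would have inner product \<open>-1\<close> on any other block,
  and the sum of all rows would have negative squared length there.\<close>

lemma not_all_rows_agree:
  assumes x: "x < p\<^sup>2" and i: "i \<in> {1..p + 1}"
  shows "\<exists>z<p\<^sup>2. z \<notin> row_class i x"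
proof (rule ccontr)
  assume "\<not> ?thesis"
  then have agree: "y \<in> row_class i y'" if "y < p\<^sup>2" "y' < p\<^sup>2" for y y'
    using that by (auto simp: row_class_def)
  obtain k where k: "k \<in> {1..p + 1}" "k \<noteq> i"
  proof (cases "i = 1")
    case True
    then show ?thesis using that[of 2] p_ge_3 by simp
  next
    case False
    then show ?thesis using that[of 1] by simp
  qed
  have "row_class k y = {y}" if y: "y < p\<^sup>2" for y
  proof -
    have "y' = y" if y': "y' \<in> row_class k y" for y'
    proof (rule ccontr)
      assume "y' \<noteq> y"
      moreover have "y' < p\<^sup>2" using y' by (simp add: row_class_def)
      then have "y' \<in> row_class i y" using y agree by blast
      ultimately show False using row_class_unique[OF y i k(1) _ y'] k(2) by blast
    qed
    then show ?thesis using y by (auto simp: row_class_def)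
  qed
  then have "(\<Sum>y'<p\<^sup>2. block_ip k y y') = int p + 1 - (int p)\<^sup>2" if "y < p\<^sup>2" for y
    using sum_ip_row[OF that k(1)] that by simp
  then have "(\<Sum>j\<in>C k. (column_sum j)\<^sup>2) = int (p\<^sup>2) * (int p + 1 - (int p)\<^sup>2)"
    unfolding sum_column_sum_squares by simp
  moreover have "(\<Sum>j\<in>C k. (column_sum j)\<^sup>2) \<ge> 0" by (simp add: sum_nonneg)
  ultimately have "int (p\<^sup>2) * (int p + 1 - (int p)\<^sup>2) \<ge> 0" by simp
  moreover have "int p * 3 \<le> (int p)\<^sup>2" using p_ge_3 by (simp add: power2_eq_square)
  then have "int p + 1 - (int p)\<^sup>2 < 0" using p_ge_3 by linarith
  moreover have "int (p\<^sup>2) > 0" using p_ge_3 by simp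
  ultimately show False by (meson mult_pos_neg not_le)
qed

text \<open>Choose a row \<open>z\<close> outside the line \<open>row_class i x\<close>. Each point of that line is joined to \<open>z\<close> by a line
  of some other block; these blocks are distinct, since two points of \<open>row_class i x\<close> have only that
  line in common. There are \<open>p\<close> other blocks.\<close>

lemma card_row_class_le:
  assumes x: "x < p\<^sup>2" and i: "i \<in> {1..p + 1}"
  shows "card (row_class i x) \<le> p"
proof -
  obtain z where z: "z < p\<^sup>2" "z \<notin> row_class i x"
    using not_all_rows_agree[OF assms] by blast
  have "\<exists>k\<in>{1..p + 1}. y \<in> row_class k z" if y: "y \<in> row_class i x" for y
  proof -
    have "y < p\<^sup>2" "z \<noteq> y" using y z by (auto simp: row_class_def)
    then show ?thesis using block_ip_net[OF z(1)] row_class_iff[OF z(1)] by blast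
  qed
  \<comment> \<open>\<open>f y\<close> is the block of the line through \<open>y\<close> and \<open>z\<close>.\<close>
  then obtain f where f: "\<And>y. y \<in> row_class i x \<Longrightarrow> f y \<in> {1..p + 1} \<and> y \<in> row_class (f y) z"
    by metis
  have ne: "f y \<noteq> i" if "y \<in> row_class i x" for y
    using f[OF that] that z by (auto simp: row_class_def)
  have "f ` row_class i x \<subseteq> {1..p + 1} - {i}" using f ne by blast
  moreover have "inj_on f (row_class i x)"
  proof (rule inj_onI, rule ccontr)
    fix y y' assume y: "y \<in> row_class i x" "y' \<in> row_class i x" "f y = f y'" "y \<noteq> y'"
    have "y' \<in> row_class i y" using y(1,2) by (auto simp: row_class_def)
    moreover have "y' \<in> row_class (f y) y"
      using f[OF y(1)] f[OF y(2)] y(3) by (auto simp: row_class_def)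
    moreover have "y < p\<^sup>2" using y(1) by (simp add: row_class_def)
    ultimately have "i = f y" using row_class_unique[of y i "f y" y'] i f[OF y(1)] y(4) by blast
    then show False using ne y(1) by blast
  qed
  ultimately have "card (row_class i x) \<le> card ({1..p + 1} - {i})"
    by (meson card_inj_on_le finite_Diff finite_atLeastAtMost)
  then show ?thesis using i by simp
qed

lemma sum_ip_blocks:
  assumes x: "x < p\<^sup>2" and y: "y < p\<^sup>2"
  shows "(\<Sum>i\<in>{1..p + 1}. block_ip i x y) = (if x = y then int p * (int p + 1) else 0)"
proof (cases "x = y")
  case True
  then show ?thesis using block_ip_self[OF x] by simp
next
  case False
  obtain i where i: "i \<in> {1..p + 1}" "block_ip i x y = int p"
    "\<forall>k\<in>{1..p + 1} - {i}. block_ip k x y = -1"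
    using block_ip_net[OF x y False] by blast
  have "(\<Sum>k\<in>{1..p + 1}. block_ip k x y) = block_ip i x y + (\<Sum>k\<in>{1..p + 1} - {i}. block_ip k x y)"
    using i(1) by (intro sum.remove) auto
  also have "(\<Sum>k\<in>{1..p + 1} - {i}. block_ip k x y) = - int p" using i by simp
  finally show ?thesis using i False by simp
qed

text \<open>Each of the \<open>p + 1\<close> blocks contributes at most \<open>p\<close>, by the bound on the size of a line. The total is
  \<open>p * (p + 1)\<close>, since only the inner products of row \<open>x\<close> with itself survive the sum over the
  blocks. So every block contributes exactly \<open>p\<close>.\<close>

lemma sum_ip_row_eq:
  assumes x: "x < p\<^sup>2" and i: "i \<in> {1..p + 1}"
  shows "(\<Sum>y<p\<^sup>2. block_ip i x y) = int p"
proof -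
  have le: "(\<Sum>y<p\<^sup>2. block_ip k x y) \<le> int p" if "k \<in> {1..p + 1}" for k
  proof -
    have "(int p + 1) * int (card (row_class k x)) \<le> (int p + 1) * int p"
      using card_row_class_le[OF x that] by (intro mult_left_mono) auto
    then show ?thesis
      unfolding sum_ip_row[OF x that] by (simp add: power2_eq_square algebra_simps)
  qed
  have "(\<Sum>k\<in>{1..p + 1}. \<Sum>y<p\<^sup>2. block_ip k x y) = (\<Sum>y<p\<^sup>2. \<Sum>k\<in>{1..p + 1}. block_ip k x y)"
    by (rule sum.swap)
  also have "\<dots> = (\<Sum>y<p\<^sup>2. if x = y then int p * (int p + 1) else 0)"
    using sum_ip_blocks[OF x] by (intro sum.cong) auto
  also have "\<dots> = int p * (int p + 1)" using x by simp
  finally have "(\<Sum>k\<in>{1..p + 1}. int p - (\<Sum>y<p\<^sup>2. block_ip k x y)) = 0"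
    by (simp add: sum_subtractf)
  then have "\<forall>k\<in>{1..p + 1}. int p - (\<Sum>y<p\<^sup>2. block_ip k x y) = 0"
    using le by (subst (asm) sum_nonneg_eq_0_iff) auto
  then show ?thesis using i by auto
qed

lemma card_row_class:
  assumes "x < p\<^sup>2" "i \<in> {1..p + 1}"
  shows "card (row_class i x) = p"
proof -
  have "(int p + 1) * int (card (row_class i x)) = (int p + 1) * int p"
    using sum_ip_row[OF assms] sum_ip_row_eq[OF assms] by (simp add: power2_eq_square algebra_simps)
  then show ?thesis by simp
qed

text \<open>The rows split into lines of the block \<open>i\<close>; the column is constant on each of them, and each has
  \<open>p\<close> points.\<close>

lemma dvd_column_sum:
  assumes i: "i \<in> {1..p + 1}" and j: "j \<in> C i"
  shows "int p dvd column_sum j"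
proof -
  \<comment> \<open>The lines are the fibres of the map that restricts a row to the block.\<close>
  have "column_sum j = (\<Sum>c\<in>(\<lambda>x. restrict (H x) (C i)) ` {..<p\<^sup>2}.
      \<Sum>y\<in>{y \<in> {..<p\<^sup>2}. restrict (H y) (C i) = c}. H y j)"
    unfolding column_sum_def by (rule sum.image_gen) simp
  also have "int p dvd \<dots>"
  proof (rule dvd_sum)
    fix c assume "c \<in> (\<lambda>x. restrict (H x) (C i)) ` {..<p\<^sup>2}"
    then obtain x where x: "x < p\<^sup>2" "c = restrict (H x) (C i)" by auto
    have "{y \<in> {..<p\<^sup>2}. restrict (H y) (C i) = c} = row_class i x"
      unfolding row_class_def x(2) by
        (auto simp: restrict_def fun_eq_iff)
    moreover have "(\<Sum>y\<in>row_class i x. H y j) = (\<Sum>y\<in>row_class i x. H x j)"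
      using j by (intro sum.cong) (auto simp: row_class_def)
    ultimately show "int p dvd (\<Sum>y\<in>{y \<in> {..<p\<^sup>2}. restrict (H y) (C i) = c}. H y j)"
      using card_row_class[OF x(1) i] by simp
  qed
  finally show ?thesis .
qed

lemma odd_column_sum:
  assumes i: "i \<in> {1..p + 1}" and j: "j \<in> C i"
  shows "odd (column_sum j)"
proof -
  have "column_sum j = 2 * int (card {x \<in> {..<p\<^sup>2}. H x j = 1}) - int (card {..<p\<^sup>2})"
    unfolding column_sum_def using sign[OF _ i j] by (intro sum_signs) auto
  then show ?thesis using odd_p by simp
qed

text \<open>An odd multiple of \<open>p\<close> has square at least \<open>p\<^sup>2\<close>, while the squares of the \<open>p\<close> column sums of a
  block have mean \<open>p\<^sup>2\<close>.\<close>

lemma column_sum_squares: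
  assumes i: "i \<in> {1..p + 1}" and j: "j \<in> C i"
  shows "(column_sum j)\<^sup>2 = (int p)\<^sup>2"
proof -
  have ge: "(int p)\<^sup>2 \<le> (column_sum k)\<^sup>2" if "k \<in> C i" for k
  proof -
    have "column_sum k \<noteq> 0" using odd_column_sum[OF i that] by auto
    then have "int p \<le> \<bar>column_sum k\<bar>"
      using dvd_imp_le_int[OF _ dvd_column_sum[OF i that]] by simp
    then show ?thesis by (metis abs_le_square_iff abs_of_nat)
  qed
  have "(\<Sum>k\<in>C i. (column_sum k)\<^sup>2) = int p * (int p)\<^sup>2"
    unfolding sum_column_sum_squares using sum_ip_row_eq[OF _ i] by simp
  then have "(\<Sum>k\<in>C i. (column_sum k)\<^sup>2 - (int p)\<^sup>2) = 0"
    using card_C[OF i] by (simp add: sum_subtractf)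
  then have "\<forall>k\<in>C i. (column_sum k)\<^sup>2 - (int p)\<^sup>2 = 0"
    using ge finite_C[OF i] by (subst (asm) sum_nonneg_eq_0_iff) auto
  then show ?thesis using j by simp
qed

text \<open>Multiplication by this sign makes the column sum negative.\<close>

definition column_sign :: "nat \<Rightarrow> int" where
  "column_sign j = - sgn (column_sum j)"

lemma column_sum_eq:
  assumes "i \<in> {1..p + 1}" "j \<in> C i"
  shows "column_sum j = - column_sign j * int p" "column_sign j \<in> {1, -1}"
proof -
  have "\<bar>column_sum j\<bar> = int p"
    using column_sum_squares[OF assms] by (metis abs_of_nat power2_eq_iff_nonneg abs_ge_zero power2_abs)
  then show "column_sum j = - column_sign j * int p" "column_sign j \<in> {1, -1}"
    using p_ge_3 unfolding column_sign_def by (auto simp: sgn_if split: if_splits)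
qed

lemma normalized_column_sum:
  assumes "i \<in> {1..p + 1}" "j \<in> C i"
  shows "(\<Sum>x<p\<^sup>2. column_sign j * H x j) = - int p"
proof -
  have "(\<Sum>x<p\<^sup>2. column_sign j * H x j) = column_sign j * column_sum j"
    by (simp add: column_sum_def sum_distrib_left)
  then show ?thesis using column_sum_eq[OF assms] by auto
qed

text \<open>Up to the factor \<open>- p\<close>, the column signs of a block are its column sums, so the left side is
  \<open>- 1 / p\<close> times the inner product of row \<open>x\<close> with the sum of all rows.\<close>

lemma normalized_row_sum:
  assumes x: "x < p\<^sup>2" and i: "i \<in> {1..p + 1}"
  shows "(\<Sum>j\<in>C i. column_sign j * H x j) = -1"
proof -
  have "int p * (\<Sum>j\<in>C i. column_sign j * H x j) = - (\<Sum>j\<in>C i. H x j * column_sum j)"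
    using column_sum_eq(1)[OF i] by (simp add: sum_distrib_left sum_negf[symmetric] mult_ac)
  also have "\<dots> = - int p"
    unfolding sum_column_sum using sum_ip_row_eq[OF assms] by simp
  finally have "int p * (\<Sum>j\<in>C i. column_sign j * H x j) = int p * -1" by simp
  then show ?thesis using p_ge_3 by (metis mult_left_cancel not_numeral_le_zero of_nat_eq_0_iff)
qed

end

section \<open>Normalized sign matrices are incidence matrices of designs\<close>

text \<open>The sign matrix \<open>2 * D - J\<close> of an incidence matrix \<open>D\<close> whose blocks have row sums \<open>(p - 1) / 2\<close>,
  where \<open>J\<close> is the all-one matrix.\<close>

locale normalized_blocks = sign_blocks +
  assumes row_sum: "x < p\<^sup>2 \<Longrightarrow> i \<in> {1..p + 1} \<Longrightarrow> (\<Sum>j\<in>C i. H x j) = -1"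
begin

lemma card_positive:
  assumes S: "S \<subseteq> {1..p + 1}" and x: "x < p\<^sup>2"
  shows "2 * card {j \<in> (\<Union>i\<in>S. C i). H x j = 1} = card S * (p - 1)"
proof -
  have "(\<Sum>j\<in>(\<Union>i\<in>S. C i). H x j) = - int (card S)"
    using row_sum[OF x] S by (simp add: sum_columns[OF S] subset_iff)
  moreover have "(\<Sum>j\<in>(\<Union>i\<in>S. C i). H x j)
      = 2 * int (card {j \<in> (\<Union>i\<in>S. C i). H x j = 1}) - int (card S * p)"
    unfolding card_columns[OF S, symmetric]
    using finite_columns[OF S] sign[OF x] S by (intro sum_signs) blast+
  ultimately have "int (2 * card {j \<in> (\<Union>i\<in>S. C i). H x j = 1}) = int (card S * (p - 1))"
    using p_ge_3 by (simp add: algebra_simps)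
  then show ?thesis by (simp only: of_nat_eq_iff)
qed

lemma sum_products_eq:
  assumes S: "S \<subseteq> {1..p + 1}" and x: "x < p\<^sup>2" and y: "y < p\<^sup>2"
  shows "(\<Sum>j\<in>(\<Union>i\<in>S. C i). H x j * H y j)
    = 4 * int (card {j \<in> (\<Union>i\<in>S. C i). H x j = 1 \<and> H y j = 1}) - int (card S) * (int p - 2)"
proof -
  have "(\<Sum>j\<in>(\<Union>i\<in>S. C i). H x j * H y j)
    = 4 * int (card {j \<in> (\<Union>i\<in>S. C i). H x j = 1 \<and> H y j = 1})
      - int (2 * card {j \<in> (\<Union>i\<in>S. C i). H x j = 1})
      - int (2 * card {j \<in> (\<Union>i\<in>S. C i). H y j = 1}) + int (card S * p)"
    unfolding card_columns[OF S, symmetric] of_nat_mult of_nat_numeral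
    using finite_columns[OF S] sign[OF x] sign[OF y] S by (intro sum_sign_products) blast+
  also have "\<dots> = 4 * int (card {j \<in> (\<Union>i\<in>S. C i). H x j = 1 \<and> H y j = 1})
      - int (card S) * (int p - 2)"
    unfolding card_positive[OF S x] card_positive[OF S y]
    using p_ge_3 by (simp add: algebra_simps)
  finally show ?thesis .
qed

text \<open>By \<open>sum_products_eq\<close> the inner product vanishes when four times the number of common columns is
  \<open>(p + 1) * (p - 2) = p\<^sup>2 - p - 2\<close>. Writing \<open>p = 4 * t + 3\<close> makes the division exact.\<close>

lemma orth_iff:
  assumes "x < p\<^sup>2" "y < p\<^sup>2"
  shows "(\<Sum>j\<in>(\<Union>i\<in>{1..p + 1}. C i). H x j * H y j) = 0 \<longleftrightarrow>
    card {j \<in> (\<Union>i\<in>{1..p + 1}. C i). H x j = 1 \<and> H y j = 1} = (p\<^sup>2 - p - 2) div 4"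
proof -
  obtain t where t: "p = 4 * t + 3"
    using p_mod by (metis mult_div_mod_eq)
  have arith: "4 * int m - 4 * int c = 0 \<longleftrightarrow> m = c" for m c
    by auto
  have "p\<^sup>2 - p - 2 = 4 * (4 * t\<^sup>2 + 5 * t + 1)"
    unfolding t by (simp add: power2_eq_square algebra_simps)
  then have "(p\<^sup>2 - p - 2) div 4 = 4 * t\<^sup>2 + 5 * t + 1"
    by simp
  moreover have "int (card {1..p + 1}) * (int p - 2) = 4 * int (4 * t\<^sup>2 + 5 * t + 1)"
    unfolding t by (simp add: power2_eq_square algebra_simps)
  ultimately show ?thesis
    unfolding sum_products_eq[OF order_refl assms] by (simp only:, intro arith)
qed

text \<open>By \<open>sum_products_eq\<close>, with \<open>h = (p + 1) / 2\<close> blocks the inner product is \<open>\<plusminus>h\<close> when four times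
  the number of common columns is \<open>h * (p - 2) \<plusminus> h\<close>, that is \<open>(p\<^sup>2 - 1) / 2\<close> or
  \<open>(p\<^sup>2 - 2 * p - 3) / 2\<close>.\<close>

lemma half_iff:
  assumes S: "S \<subseteq> {1..p + 1}" "card S = (p + 1) div 2" and xy: "x < p\<^sup>2" "y < p\<^sup>2"
  shows "(\<Sum>j\<in>(\<Union>i\<in>S. C i). H x j * H y j) \<in> {int ((p + 1) div 2), - int ((p + 1) div 2)} \<longleftrightarrow>
    card {j \<in> (\<Union>i\<in>S. C i). H x j = 1 \<and> H y j = 1} \<in> {(p\<^sup>2 - 1) div 8, (p\<^sup>2 - 2 * p - 3) div 8}"
proof -
  obtain t where t: "p = 4 * t + 3"
    using p_mod by (metis mult_div_mod_eq)
  have arith: "4 * int m - int a \<in> {int b, - int b} \<longleftrightarrow> m \<in> {c, d}"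
    if "a + b = 4 * c" "a = 4 * d + b" for m a b c d
    using that by auto
  have "p\<^sup>2 - 1 = 8 * (2 * t\<^sup>2 + 3 * t + 1)" "p\<^sup>2 - 2 * p - 3 = 8 * (2 * t\<^sup>2 + 2 * t)"
    unfolding t by (simp_all add: power2_eq_square algebra_simps)
  then have "(p\<^sup>2 - 1) div 8 = 2 * t\<^sup>2 + 3 * t + 1" "(p\<^sup>2 - 2 * p - 3) div 8 = 2 * t\<^sup>2 + 2 * t"
    by simp_all
  moreover have h: "(p + 1) div 2 = 2 * t + 2" unfolding t by simp
  moreover have "int (card S) * (int p - 2) = int (8 * t\<^sup>2 + 10 * t + 2)"
    unfolding S(2) h unfolding t by (simp add: power2_eq_square algebra_simps)
  ultimately show ?thesis
    unfolding sum_products_eq[OF S(1) xy] by (simp only:, intro arith) auto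
qed

end

lemma size_filter_mset_nth:
  "size (filter_mset P (mset xs)) = card {j \<in> {..<length xs}. P (xs ! j)}"
  by (simp add: length_filter_conv_card flip: mset_filter)

text \<open>The points are the rows, and the blocks of the design are the sets of rows with entry \<open>1\<close> in a
  column. The column sums \<open>- p\<close> are what gives all these sets the same size.\<close>

lemma (in normalized_blocks) multi_splittable_bibd_of_signs:
  assumes split: "balanced_split p H C"
    and cover: "(\<Union>i\<in>{1..p + 1}. C i) = {..<p * (p + 1)}"
    and column_sum: "\<And>j. j < p * (p + 1) \<Longrightarrow> (\<Sum>x<p\<^sup>2. H x j) = - int p"
  shows "multi_splittable_bibd p {..<p\<^sup>2}
    (mset (map (\<lambda>j. {x \<in> {..<p\<^sup>2}. H x j = 1}) [0..<p * (p + 1)]))"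
proof -
  interpret balanced_split p H C by (rule split)
  define b where "b = p * (p + 1)"
  define Bs where "Bs = map (\<lambda>j. {x \<in> {..<p\<^sup>2}. H x j = 1}) [0..<b]"
  have len: "length Bs = b" by (simp add: Bs_def)
  have Bs: "x \<in> Bs ! j \<longleftrightarrow> H x j = 1" if "x < p\<^sup>2" "j < b" for x j
    using that by (simp add: Bs_def)
  note cover = cover[folded b_def]
  have point: "{j \<in> J. x \<in> Bs ! j} = {j \<in> J. H x j = 1}"
    if "J \<subseteq> {..<b}" "x < p\<^sup>2" for J x
    using Bs[OF that(2)] that(1) by blast
  have pair: "{j \<in> J. x \<in> Bs ! j \<and> y \<in> Bs ! j} = {j \<in> J. H x j = 1 \<and> H y j = 1}"
    if "J \<subseteq> {..<b}" "x < p\<^sup>2" "y < p\<^sup>2" for J x y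
    using Bs[OF that(2)] Bs[OF that(3)] that(1) by blast
  have block: "card {x \<in> {..<p\<^sup>2}. H x j = 1} = (p\<^sup>2 - p) div 2" if j: "j < b" for j
  proof -
    obtain i where i: "i \<in> {1..p + 1}" "j \<in> C i" using j cover by blast
    have "(\<Sum>x<p\<^sup>2. H x j) = 2 * int (card {x \<in> {..<p\<^sup>2}. H x j = 1}) - int (card {..<p\<^sup>2})"
      using sign[OF _ i] by (intro sum_signs) auto
    then have "2 * int (card {x \<in> {..<p\<^sup>2}. H x j = 1}) = int (p\<^sup>2) - int p"
      using column_sum[folded b_def, OF j] by simp
    then show ?thesis by linarith
  qed
  have bibd: "bibd {..<p\<^sup>2} (mset Bs) (p\<^sup>2) (p\<^sup>2 + p) ((p\<^sup>2 - 1) div 2) ((p\<^sup>2 - p) div 2)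
      ((p\<^sup>2 - p - 2) div 4)"
    unfolding bibd_def
  proof (intro conjI ballI impI)
    show "size (mset Bs) = p\<^sup>2 + p" by (simp add: len b_def power2_eq_square)
    show "B \<subseteq> {..<p\<^sup>2}" "card B = (p\<^sup>2 - p) div 2" if "B \<in># mset Bs" for B
      using that block by (auto simp: Bs_def)
  next
    fix x assume "x \<in> {..<p\<^sup>2}"
    then have "size {#B \<in># mset Bs. x \<in> B#} = card {j \<in> {..<b}. H x j = 1}"
      using point[OF order_refl] by (simp add: size_filter_mset_nth len)
    moreover have "2 * card {j \<in> {..<b}. H x j = 1} = p\<^sup>2 - 1"
      using card_positive[OF order_refl, of x] \<open>x \<in> _\<close> p_ge_3
      unfolding cover by (simp add: power2_eq_square algebra_simps)
    ultimately show "size {#B \<in># mset Bs. x \<in> B#} = (p\<^sup>2 - 1) div 2" by simp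
  next
    fix x y assume xy: "x \<in> {..<p\<^sup>2}" "y \<in> {..<p\<^sup>2}" "x \<noteq> y"
    then have "size {#B \<in># mset Bs. x \<in> B \<and> y \<in> B#} = card {j \<in> {..<b}. H x j = 1 \<and> H y j = 1}"
      using pair[OF order_refl] by (simp add: size_filter_mset_nth len)
    then show "size {#B \<in># mset Bs. x \<in> B \<and> y \<in> B#} = (p\<^sup>2 - p - 2) div 4"
      using orth[of x y] orth_iff[of x y] xy unfolding cover by simp
  qed auto
  define D where "D = incidence_matrix [0..<p\<^sup>2] Bs"
  have D: "dim_row D = p\<^sup>2" "dim_col D = b"
    by (simp_all add: D_def incidence_matrix_def len)
  have form: "block_form (p + 1) p D C"
    unfolding block_form_def D using disj cover card_C by blast
  have rows: "(\<Sum>j<p. sub_blocks D C {i} $$ (x, j)) = int ((p - 1) div 2)"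
    if i: "i \<in> {1..p + 1}" and x: "x < p\<^sup>2" for i x
  proof -
    have Ci: "C i \<subseteq> {..<b}" using cover i by blast
    have "(\<Sum>j<p. sub_blocks D C {i} $$ (x, j)) = (\<Sum>j\<in>C i. D $$ (x, j))"
      using sum_submatrix_cols[of "C i" D x] D Ci x card_C[OF i] by (simp add: sub_blocks_def)
    also have "\<dots> = (\<Sum>j\<in>C i. of_bool (H x j = 1))"
      using Ci x Bs by (intro sum.cong) (auto simp: D_def incidence_matrix_def len)
    also have "\<dots> = int (card {j \<in> C i. H x j = 1})"
      using finite_C[OF i] by (simp add: Int_def)
    also have "2 * card {j \<in> C i. H x j = 1} = p - 1"
      using card_positive[of "{i}" x] i x by simp
    then have "card {j \<in> C i. H x j = 1} = (p - 1) div 2" by simp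
    finally show ?thesis .
  qed
  have halves: "card {j \<in> (\<Union>i\<in>S. C i). x \<in> Bs ! j \<and> y \<in> Bs ! j}
      \<in> {(p\<^sup>2 - 1) div 8, (p\<^sup>2 - 2 * p - 3) div 8}"
    if S: "S \<subseteq> {1..p + 1}" "card S = (p + 1) div 2" and xy: "x < p\<^sup>2" "y < p\<^sup>2" "x \<noteq> y" for S x y
  proof -
    have J: "(\<Union>i\<in>S. C i) \<subseteq> {..<b}" using cover S(1) by blast
    show ?thesis
      unfolding pair[OF J xy(1,2)] half_iff[OF S xy(1,2), symmetric] by (rule half[OF S xy])
  qed
  have "multi_splittable_bibd p {..<p\<^sup>2} (mset Bs)"
    unfolding multi_splittable_bibd_def Let_def
  proof (intro conjI exI)
    show "mset Bs = mset Bs" ..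
    show "distinct [0..<p\<^sup>2]" "set [0..<p\<^sup>2] = {..<p\<^sup>2}" by auto
    show "block_form (p + 1) p (incidence_matrix [0..<p\<^sup>2] Bs) C"
      using form unfolding D_def .
    show "\<forall>i\<in>{1..p + 1}. \<forall>x<p\<^sup>2.
        (\<Sum>j<p. sub_blocks (incidence_matrix [0..<p\<^sup>2] Bs) C {i} $$ (x, j)) = int ((p - 1) div 2)"
      using rows unfolding D_def by (intro ballI allI impI)
    show "\<forall>S\<subseteq>{1..p + 1}. card S = (p + 1) div 2 \<longrightarrow> (\<forall>x\<in>{..<p\<^sup>2}. \<forall>y\<in>{..<p\<^sup>2}. x \<noteq> y \<longrightarrow>
        card {j \<in> (\<Union>i\<in>S. C i). x \<in> Bs ! j \<and> y \<in> Bs ! j}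
          \<in> {(p\<^sup>2 - 1) div 8, (p\<^sup>2 - 2 * p - 3) div 8})"
      by (intro allI ballI impI halves) auto
  qed (rule bibd)
  then show ?thesis unfolding Bs_def b_def .
qed

text \<open>The row signs come from the pair signs and the column signs from the column sums of the switched
  matrix. Inner products on blocks change only by the row signs, so half sums stay in \<open>{h, - h}\<close>
  with \<open>h = (p + 1) / 2\<close>.\<close>

lemma multi_splittable_bibd_of_hadamard:
  assumes p: "p mod 4 = 3" and H: "multi_splittable_hadamard p H"
  shows "\<exists>(V :: nat set) \<B>. multi_splittable_bibd p V \<B>"
proof -
  obtain C where cover: "(\<Union>i\<in>{1..p + 1}. C i) = {..<p * (p + 1)}"
    and split: "balanced_split p (\<lambda>x j. H $$ (x, j)) C"
    using H unfolding multi_splittable_hadamard_iff[OF p] by blast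
  interpret balanced_split p "\<lambda>x j. H $$ (x, j)" C by (rule split)
  interpret net: net_split p "\<lambda>x j. pair_sign 0 x * H $$ (x, j)" C
    by (rule net_split_switched)
  define G where "G x j = net.column_sign j * (pair_sign 0 x * H $$ (x, j))" for x j
  have "G = (\<lambda>x j. pair_sign 0 x * net.column_sign j * H $$ (x, j))"
    by (intro ext) (simp add: G_def)
  then have G: "balanced_split p G C"
    using balanced_split_rescale[of "pair_sign 0" net.column_sign] pair_sign_values
      net.column_sum_eq(2) by simp
  interpret G: balanced_split p G C by (rule G)
  interpret G: normalized_blocks p G C
    by unfold_locales (unfold G_def, rule net.normalized_row_sum)
  have "(\<Sum>x<p\<^sup>2. G x j) = - int p" if "j < p * (p + 1)" for j
  proof -
    obtain i where "i \<in> {1..p + 1}" "j \<in> C i" using \<open>j < _\<close> cover by blast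
    then show ?thesis unfolding G_def by (rule net.normalized_column_sum)
  qed
  then show ?thesis
    using G.multi_splittable_bibd_of_signs[OF G cover] by blast
qed

text \<open>The matrix is \<open>2 * D - J\<close> for the incidence matrix \<open>D\<close> and the all-one matrix \<open>J\<close>.\<close>

lemma hadamard_of_multi_splittable_bibd:
  assumes p: "p mod 4 = 3" and V: "multi_splittable_bibd p V \<B>"
  shows "\<exists>H. multi_splittable_hadamard p H"
proof -
  have bibd: "bibd V \<B> (p\<^sup>2) (p\<^sup>2 + p) ((p\<^sup>2 - 1) div 2) ((p\<^sup>2 - p) div 2) ((p\<^sup>2 - p - 2) div 4)"
    using V by (simp add: multi_splittable_bibd_def)
  obtain xs Bs C where xs: "distinct xs" "set xs = V" and Bs: "mset Bs = \<B>"
    and form: "block_form (p + 1) p (incidence_matrix xs Bs) C"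
    and rows: "\<forall>i\<in>{1..p + 1}. \<forall>x<p\<^sup>2.
        (\<Sum>j<p. sub_blocks (incidence_matrix xs Bs) C {i} $$ (x, j)) = int ((p - 1) div 2)"
    and halves: "\<forall>S\<subseteq>{1..p + 1}. card S = (p + 1) div 2 \<longrightarrow> (\<forall>x\<in>V. \<forall>y\<in>V. x \<noteq> y \<longrightarrow>
        card {j \<in> (\<Union>i\<in>S. C i). x \<in> Bs ! j \<and> y \<in> Bs ! j}
          \<in> {(p\<^sup>2 - 1) div 8, (p\<^sup>2 - 2 * p - 3) div 8})"
    using V unfolding multi_splittable_bibd_def Let_def by blast
  define b where "b = p * (p + 1)"
  define D where "D = incidence_matrix xs Bs"
  have lxs: "length xs = p\<^sup>2"
    using bibd xs by (metis bibd_def distinct_card)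
  have lBs: "length Bs = b"
    using bibd Bs by (simp add: bibd_def b_def power2_eq_square flip: size_mset)
  have dims: "dim_row D = p\<^sup>2" "dim_col D = b"
    by (simp_all add: D_def incidence_matrix_def lxs lBs)
  have disj: "disjoint_family_on C {1..p + 1}" and cover: "(\<Union>i\<in>{1..p + 1}. C i) = {..<b}"
    and card_C: "\<And>i. i \<in> {1..p + 1} \<Longrightarrow> card (C i) = p"
    using form unfolding D_def[symmetric] block_form_def dims by blast+
  define M where "M = mat (p\<^sup>2) b (\<lambda>(x, j). 2 * D $$ (x, j) - 1)"
  define H where "H x j = M $$ (x, j)" for x j
  have H_eq: "H x j = 2 * D $$ (x, j) - 1" if "x < p\<^sup>2" "j < b" for x j
    using that by (simp add: H_def M_def)
  have D_eq: "D $$ (x, j) = of_bool (xs ! x \<in> Bs ! j)" if "x < p\<^sup>2" "j < b" for x j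
    using that by (simp add: D_def incidence_matrix_def lxs lBs)
  have one: "H x j = 1 \<longleftrightarrow> xs ! x \<in> Bs ! j" if "x < p\<^sup>2" "j < b" for x j
    using that by (simp add: H_eq D_eq)
  interpret sign_blocks p H C
  proof
    show "H x j \<in> {1, -1}" if "x < p\<^sup>2" "i \<in> {1..p + 1}" "j \<in> C i" for x i j
    proof -
      have "j < b" using that cover by blast
      then show ?thesis using that(1) by (simp add: H_eq D_eq)
    qed
  qed (fact p disj card_C)+
  interpret normalized_blocks p H C
  proof
    fix x i assume x: "x < p\<^sup>2" and i: "i \<in> {1..p + 1}"
    have Ci: "C i \<subseteq> {..<b}" using cover i by blast
    have "(\<Sum>j\<in>C i. D $$ (x, j)) = (\<Sum>j<p. sub_blocks D C {i} $$ (x, j))"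
      using sum_submatrix_cols[of "C i" D x] dims Ci x card_C[OF i] by (simp add: sub_blocks_def)
    also have "\<dots> = int ((p - 1) div 2)"
      using rows i x unfolding D_def by blast
    finally have "(\<Sum>j\<in>C i. D $$ (x, j)) = int ((p - 1) div 2)" .
    moreover have "(\<Sum>j\<in>C i. H x j) = 2 * (\<Sum>j\<in>C i. D $$ (x, j)) - int p"
    proof -
      have "(\<Sum>j\<in>C i. H x j) = (\<Sum>j\<in>C i. 2 * D $$ (x, j) - 1)"
        using Ci x by (intro sum.cong) (auto simp: H_eq)
      then show ?thesis
        using card_C[OF i] by (simp add: sum_subtractf sum_distrib_left)
    qed
    moreover have "2 * int ((p - 1) div 2) = int p - 1"
      using odd_p by (auto elim: oddE)
    ultimately show "(\<Sum>j\<in>C i. H x j) = -1" by simp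
  qed
  have pair: "{j \<in> J. H x j = 1 \<and> H y j = 1} = {j \<in> J. xs ! x \<in> Bs ! j \<and> xs ! y \<in> Bs ! j}"
    if "J \<subseteq> {..<b}" "x < p\<^sup>2" "y < p\<^sup>2" for J x y
    using one[OF that(2)] one[OF that(3)] that(1) by blast
  have points: "xs ! x \<in> V" "xs ! y \<in> V" "xs ! x \<noteq> xs ! y"
    if "x < p\<^sup>2" "y < p\<^sup>2" "x \<noteq> y" for x y
    using that xs lxs by (auto simp: nth_eq_iff_index_eq)
  have "balanced_split p H C"
  proof
    fix x y assume xy: "x < p\<^sup>2" "y < p\<^sup>2" "x \<noteq> y"
    have "card {j \<in> {..<b}. xs ! x \<in> Bs ! j \<and> xs ! y \<in> Bs ! j} = (p\<^sup>2 - p - 2) div 4"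
      using bibd points[OF xy] unfolding bibd_def Bs[symmetric] size_filter_mset_nth lBs by blast
    then show "(\<Sum>j\<in>(\<Union>i\<in>{1..p + 1}. C i). H x j * H y j) = 0"
      using orth_iff[OF xy(1,2)] unfolding cover pair[OF order_refl xy(1,2)] by blast
    fix S assume S: "S \<subseteq> {1..p + 1}" "card S = (p + 1) div 2"
    have J: "(\<Union>i\<in>S. C i) \<subseteq> {..<b}" using cover S(1) by blast
    show "(\<Sum>j\<in>(\<Union>i\<in>S. C i). H x j * H y j) \<in> {int ((p + 1) div 2), - int ((p + 1) div 2)}"
      unfolding half_iff[OF S xy(1,2)] pair[OF J xy(1,2)]
      using halves[rule_format, OF S points[OF xy]] .
  qed
  moreover have "M \<in> carrier_mat (p\<^sup>2) b" by (simp add: M_def)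
  ultimately show ?thesis
    using cover unfolding multi_splittable_hadamard_iff[OF p] H_def b_def by blast
qed

theorem theorem4p3:
  fixes p :: nat
  assumes "p > 0" and "p mod 4 = 3"
  shows "(\<exists>H. multi_splittable_hadamard p H) \<longleftrightarrow>
         (\<exists>(V :: nat set) \<B>. multi_splittable_bibd p V \<B>)"
  using multi_splittable_bibd_of_hadamard hadamard_of_multi_splittable_bibd assms(2) by blast

end
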